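(* Fix $\delta>0$. The quenching time $T=T(\lambda,\delta)$ of the solution $u$ of $(F_{\lambda,\delta})$ satisfies $$\limsup_{\lambda\to\infty}\lambda\,T(\lambda,\delta)=\frac13 .$$
   Context: $\Omega\subset\mathbb{R}^n$ is a bounded domain, $\lambda>0$, $\delta>0$. The parabolic problem $(F_{\lambda,\delta})$ is $$u_t-\Delta u=\lambda\frac{1+\delta|\nabla u|^2}{(1-u)^2}\ \text{ in }\Omega\times[0,T),\qquad u=0\ \text{ on }\partial\Omega\times[0,T),\qquad u(x,0)=0\ \text{ for }x\in\Omega.$$ The quenching time is $T=T(\lambda,\delta)=\sup\{t>0:\ \|u(\cdot,\tau)\|_\infty<1\ \ \forall\tau\in[0,t]\}$; it is finite for all sufficiently large $\lambda$. *)

theory Defs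
  imports "HOL-Analysis.Analysis"
begin

text \<open>
  \<open>u x t\<close> is a function of position and time. The lifespan \<open>S\<close> of a solution is an extended real,
  so that \<open>S = \<infinity>\<close> covers global solutions.
\<close>

definition time_interval :: "ereal \<Rightarrow> real set" where
  "time_interval S = {t. 0 \<le> t \<and> ereal t < S}"

text \<open>
  \<open>u\<close> is of class \<open>C\<^sup>2\<close> in space and \<open>C\<^sup>1\<close> in time on \<open>\<Omega> \<times> J\<close>, with time derivative \<open>ut\<close>, spatial
  gradient \<open>Du\<close>, and \<open>D2u x t h\<close> the derivative of the gradient in direction \<open>h\<close>. For
  \<open>J = time_interval S\<close> the time derivative at \<open>t = 0\<close> is one-sided.
\<close>

definition C21_derivs ::
  "'a::euclidean_space set \<Rightarrow> real set \<Rightarrow> ('a \<Rightarrow> real \<Rightarrow> real) \<Rightarrow>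
   ('a \<Rightarrow> real \<Rightarrow> real) \<Rightarrow> ('a \<Rightarrow> real \<Rightarrow> 'a) \<Rightarrow> ('a \<Rightarrow> real \<Rightarrow> 'a \<Rightarrow> 'a) \<Rightarrow> bool" where
  "C21_derivs \<Omega> J u ut Du D2u \<longleftrightarrow>
     (\<forall>x\<in>\<Omega>. \<forall>t\<in>J.
        ((\<lambda>s. u x s) has_real_derivative ut x t) (at t within J) \<and>
        GDERIV (\<lambda>y. u y t) x :> Du x t \<and>
        ((\<lambda>y. Du y t) has_derivative D2u x t) (at x)) \<and>
     continuous_on (\<Omega> \<times> J) (\<lambda>(x, t). ut x t) \<and>
     continuous_on (\<Omega> \<times> J) (\<lambda>(x, t). Du x t) \<and>
     (\<forall>b\<in>Basis. continuous_on (\<Omega> \<times> J) (\<lambda>(x, t). D2u x t b))"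

definition laplacian_of_D2 :: "('a::euclidean_space \<Rightarrow> 'a) \<Rightarrow> real" where
  "laplacian_of_D2 H = (\<Sum>b\<in>Basis. H b \<bullet> b)"

text \<open>
  Classical solutions of \<open>(F\<^bsub>\<lambda>,\<delta>\<^esub>)\<close> on \<open>\<Omega> \<times> [0,S)\<close>. The condition \<open>u x t \<noteq> 1\<close> says that the right-hand
  side is meaningful (division by zero is total in HOL).
\<close>

definition F_solution ::
  "'a::euclidean_space set \<Rightarrow> real \<Rightarrow> real \<Rightarrow> ereal \<Rightarrow> ('a \<Rightarrow> real \<Rightarrow> real) \<Rightarrow> bool" where
  "F_solution \<Omega> lam \<delta> S u \<longleftrightarrow>
     0 < S \<and>
     continuous_on (closure \<Omega> \<times> time_interval S) (\<lambda>(x, t). u x t) \<and>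
     (\<exists>ut Du D2u. C21_derivs \<Omega> (time_interval S) u ut Du D2u \<and>
        (\<forall>x\<in>\<Omega>. \<forall>t\<in>time_interval S. u x t \<noteq> 1 \<and>
           ut x t - laplacian_of_D2 (D2u x t) =
             lam * (1 + \<delta> * (norm (Du x t))\<^sup>2) / (1 - u x t)\<^sup>2)) \<and>
     (\<forall>x\<in>frontier \<Omega>. \<forall>t\<in>time_interval S. u x t = 0) \<and>
     (\<forall>x\<in>\<Omega>. u x 0 = 0)"

definition sup_norm :: "'a set \<Rightarrow> ('a \<Rightarrow> real) \<Rightarrow> ereal" where
  "sup_norm \<Omega> v = (SUP x\<in>\<Omega>. ereal \<bar>v x\<bar>)"

text \<open>
  The solution of \<open>(F\<^bsub>\<lambda>,\<delta>\<^esub>)\<close> is followed for as long as it stays away from 1: its lifespan ends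
  only if the sup norm is not bounded away from 1. In particular it has no continuation beyond \<open>S\<close>;
  without this condition, restricting a solution to a shorter time interval would change its
  quenching time.
\<close>

definition maximal_F_solution ::
  "'a::euclidean_space set \<Rightarrow> real \<Rightarrow> real \<Rightarrow> ereal \<Rightarrow> ('a \<Rightarrow> real \<Rightarrow> real) \<Rightarrow> bool" where
  "maximal_F_solution \<Omega> lam \<delta> S u \<longleftrightarrow>
     F_solution \<Omega> lam \<delta> S u \<and>
     (S < \<infinity> \<longrightarrow> 1 \<le> (SUP t\<in>time_interval S. sup_norm \<Omega> (\<lambda>x. u x t)))"

definition quenching_time ::
  "'a set \<Rightarrow> ereal \<Rightarrow> ('a \<Rightarrow> real \<Rightarrow> real) \<Rightarrow> ereal" where
  "quenching_time \<Omega> S u =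
     Sup {ereal t | t. 0 < t \<and> ereal t < S \<and> (\<forall>\<tau>\<in>{0..t}. sup_norm \<Omega> (\<lambda>x. u x \<tau>) < 1)}"

end

theory Submission
  imports Defs "HOL-Real_Asymp.Real_Asymp"
begin

text \<open>
  The time scale \<open>1 / (3\<lambda>)\<close> is that of the problem without diffusion: the solution \<open>v\<close> of
  \<open>v' = \<lambda> / (1 - v)\<^sup>2\<close>, \<open>v 0 = 0\<close>, is given by \<open>1 - (1 - v)\<^sup>3 = 3\<lambda>t\<close> and reaches 1 at \<open>t = 1 / (3\<lambda>)\<close>.
  So the quantity to follow is \<open>z = (1 - (1 - u)\<^sup>3) / 3\<close> (\<open>quench_clock\<close>), which vanishes where \<open>u = 0\<close>
  and equals \<open>1 / 3\<close> exactly where \<open>u = 1\<close>. The substitution removes the singularity: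
  \<open>z\<^sub>t - \<Delta>z = \<lambda> (1 + \<delta>|\<nabla>u|\<^sup>2) + 2 (1 - u) |\<nabla>u|\<^sup>2\<close>.
  The right-hand side equals \<open>\<lambda>\<close> at critical points of \<open>z\<close>, and it is at least \<open>\<lambda>\<close> wherever \<open>u < 1\<close>. What
  remains is the parabolic minimum principle for the heat operator, applied three times.

  Lower bound for the quenching time. At an interior extremum of \<open>z\<close>, or of \<open>z\<close> minus a function of
  time, the gradient terms are absent, and the minimum principle gives \<open>0 \<le> z \<le> \<lambda>t\<close>
  (\<open>F_solution_clock_nonneg\<close>, \<open>F_solution_clock_le\<close>). Hence \<open>u\<close> stays away from 1 on every interval
  \<open>[0,b]\<close> with \<open>b < 1 / (3\<lambda>)\<close>; by maximality the solution lives at least until \<open>1 / (3\<lambda>)\<close>, and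
  \<open>\<lambda>T \<ge> 1 / 3\<close> for every \<open>\<lambda>\<close>.

  Upper bound. Let \<open>B\<close> be a ball of radius \<open>r\<close> about \<open>x\<^sub>0\<close> whose closure lies in \<open>\<Omega>\<close>. The function
  \<open>a t (1 - |x - x\<^sub>0|\<^sup>2 / r\<^sup>2)\<close> vanishes initially and on the boundary of \<open>B\<close>, where \<open>z \<ge> 0\<close>, and its
  image under \<open>\<partial>\<^sub>t - \<Delta>\<close> is at most \<open>a + 2nat / r\<^sup>2\<close> in dimension \<open>n\<close>. Up to time \<open>1 / (3a)\<close> this is below
  \<open>\<lambda>\<close> as soon as \<open>a < \<lambda> - 2n / (3r\<^sup>2)\<close>. Then \<open>z \<ge> at\<close> at \<open>x\<^sub>0\<close> as long as \<open>u < 1\<close>, so \<open>T \<le> 1 / (3a)\<close>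
  (\<open>quenching_time_le\<close>). Since \<open>a = \<lambda> - K\<close> is allowed for a constant \<open>K\<close> independent of \<open>\<lambda>\<close>, both bounds
  for \<open>\<lambda>T\<close> tend to \<open>1 / 3\<close>: the limit superior is a limit.
\<close>

section \<open>Derivatives of functions of space and time\<close>

text \<open>
  The pointwise part of \<open>C21_derivs\<close>: the minimum principle uses derivatives only at single points, so
  their continuity need not be carried through each substitution.
\<close>

definition parabolic_derivs ::
  "'a::euclidean_space set \<Rightarrow> real set \<Rightarrow> ('a \<Rightarrow> real \<Rightarrow> real) \<Rightarrow>
   ('a \<Rightarrow> real \<Rightarrow> real) \<Rightarrow> ('a \<Rightarrow> real \<Rightarrow> 'a) \<Rightarrow> ('a \<Rightarrow> real \<Rightarrow> 'a \<Rightarrow> 'a) \<Rightarrow> bool" where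
  "parabolic_derivs D J w wt Dw D2w \<longleftrightarrow>
     (\<forall>x\<in>D. \<forall>t\<in>J.
        (w x has_real_derivative wt x t) (at t within J) \<and>
        GDERIV (\<lambda>y. w y t) x :> Dw x t \<and>
        ((\<lambda>y. Dw y t) has_derivative D2w x t) (at x))"

lemma parabolic_derivsD:
  assumes "parabolic_derivs D J w wt Dw D2w" "x \<in> D" "t \<in> J"
  shows "(w x has_real_derivative wt x t) (at t within J)"
    and "GDERIV (\<lambda>y. w y t) x :> Dw x t"
    and "((\<lambda>y. Dw y t) has_derivative D2w x t) (at x)"
  using assms by (auto simp: parabolic_derivs_def)

lemma C21_derivs_imp_parabolic_derivs:
  "C21_derivs D J w wt Dw D2w \<Longrightarrow> parabolic_derivs D J w wt Dw D2w"
  by (simp add: C21_derivs_def parabolic_derivs_def)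

lemma parabolic_derivs_subset:
  assumes "parabolic_derivs D J w wt Dw D2w" "D' \<subseteq> D" "J' \<subseteq> J"
  shows "parabolic_derivs D' J' w wt Dw D2w"
  using assms unfolding parabolic_derivs_def by (meson DERIV_subset subsetD)

lemma parabolic_derivs_diff:
  assumes "parabolic_derivs D J v vt Dv D2v" "parabolic_derivs D J w wt Dw D2w"
  shows "parabolic_derivs D J (\<lambda>x t. v x t - w x t) (\<lambda>x t. vt x t - wt x t)
    (\<lambda>x t. Dv x t - Dw x t) (\<lambda>x t h. D2v x t h - D2w x t h)"
  using assms unfolding parabolic_derivs_def
  by (auto intro!: DERIV_diff GDERIV_diff has_derivative_diff)

lemma parabolic_derivs_compose:
  assumes u: "parabolic_derivs D J u ut Du D2u"
    and f: "\<And>v. (f has_real_derivative f' v) (at v)"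
    and f': "\<And>v. (f' has_real_derivative f'' v) (at v)"
  shows "parabolic_derivs D J (\<lambda>x t. f (u x t)) (\<lambda>x t. f' (u x t) * ut x t)
    (\<lambda>x t. f' (u x t) *\<^sub>R Du x t)
    (\<lambda>x t h. f' (u x t) *\<^sub>R D2u x t h + (f'' (u x t) * (Du x t \<bullet> h)) *\<^sub>R Du x t)"
  unfolding parabolic_derivs_def
proof (intro ballI conjI)
  fix x t assume xt: "x \<in> D" "t \<in> J"
  note d = parabolic_derivsD[OF u xt]
  show "((\<lambda>t. f (u x t)) has_real_derivative f' (u x t) * ut x t) (at t within J)"
    by (rule DERIV_chain2[OF f d(1)])
  show "GDERIV (\<lambda>y. f (u y t)) x :> f' (u x t) *\<^sub>R Du x t"
    by (rule GDERIV_DERIV_compose[OF d(2) f])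
  have "((\<lambda>y. f' (u y t)) has_derivative (\<lambda>h. f'' (u x t) * (Du x t \<bullet> h))) (at x)"
    using GDERIV_DERIV_compose[OF d(2) f'] by (simp add: gderiv_def inner_commute)
  from has_derivative_scaleR[OF this d(3)]
  show "((\<lambda>y. f' (u y t) *\<^sub>R Du y t) has_derivative
      (\<lambda>h. f' (u x t) *\<^sub>R D2u x t h + (f'' (u x t) * (Du x t \<bullet> h)) *\<^sub>R Du x t)) (at x)" .
qed

text \<open>
  The comparison functions for the transformed solution: for \<open>c = 0\<close> a spatially constant one, for
  \<open>c > 0\<close> one that is localised to a ball.
\<close>

lemma parabolic_derivs_time_times_paraboloid:
  "parabolic_derivs D J (\<lambda>x t. t * (a - c * (norm (x - x0))\<^sup>2))
     (\<lambda>x t. a - c * (norm (x - x0))\<^sup>2) (\<lambda>x t. (- 2 * c * t) *\<^sub>R (x - x0))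
     (\<lambda>x t h. (- 2 * c * t) *\<^sub>R h)"
  unfolding parabolic_derivs_def gderiv_def power2_norm_eq_inner
  by (auto intro!: derivative_eq_intros simp: algebra_simps inner_commute)

lemma laplacian_of_D2_diff:
  "laplacian_of_D2 (\<lambda>h. A h - B h) = laplacian_of_D2 A - laplacian_of_D2 B"
  by (simp add: laplacian_of_D2_def inner_diff_left sum_subtractf)

lemma laplacian_of_D2_scaleR_id:
  "laplacian_of_D2 (\<lambda>h::'a::euclidean_space. c *\<^sub>R h) = c * DIM('a)"
  by (simp add: laplacian_of_D2_def inner_Basis)

lemma laplacian_of_D2_compose:
  "laplacian_of_D2 (\<lambda>h. a *\<^sub>R A h + (b * (v \<bullet> h)) *\<^sub>R v) = a * laplacian_of_D2 A + b * (norm v)\<^sup>2"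
proof -
  have "(norm v)\<^sup>2 = (\<Sum>e\<in>Basis. (v \<bullet> e) * (v \<bullet> e))"
    by (simp add: power2_norm_eq_inner euclidean_inner[of v v])
  then show ?thesis
    by (simp add: laplacian_of_D2_def inner_add_left sum.distrib sum_distrib_left mult.assoc)
qed

section \<open>The parabolic minimum principle\<close>

text \<open>
  The gradient at a minimum vanishes. If the second derivative in direction \<open>b\<close> were negative there, the
  slope along the ray \<open>x + h b\<close> would be negative for small \<open>h > 0\<close>, and by the mean value theorem
  \<open>g\<close> would drop below its minimum.
\<close>

lemma interior_minimum_second_order:
  fixes g :: "'a::euclidean_space \<Rightarrow> real"
  assumes "open D" "x \<in> D"
    and g: "\<And>y. y \<in> D \<Longrightarrow> GDERIV g y :> G y"
    and G: "(G has_derivative H) (at x)"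
    and min: "\<And>y. y \<in> D \<Longrightarrow> g x \<le> g y"
  shows "G x = 0" and "H b \<bullet> b \<ge> 0"
proof -
  have "(\<lambda>h. h \<bullet> G x) = (\<lambda>h. 0)"
    using differential_zero_maxmin[OF \<open>x \<in> D\<close> \<open>open D\<close>, of g] g[OF \<open>x \<in> D\<close>] min
    by (auto simp: gderiv_def)
  then show G0: "G x = 0"
    by (metis inner_eq_zero_iff)
  show "H b \<bullet> b \<ge> 0"
  proof (rule ccontr)
    assume neg: "\<not> ?thesis"
    have "open ((\<lambda>h::real. x + h *\<^sub>R b) -` D)"
      by (intro continuous_open_vimage assms continuous_intros)
    then obtain e where e: "e > 0" "\<And>h. \<bar>h\<bar> < e \<Longrightarrow> x + h *\<^sub>R b \<in> D"
      using \<open>x \<in> D\<close> unfolding open_dist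
      by (metis (no_types, lifting) add.right_neutral dist_real_def diff_zero scale_zero_left vimage_eq)
    have slope: "((\<lambda>h. g (x + h *\<^sub>R b)) has_real_derivative G (x + h *\<^sub>R b) \<bullet> b) (at h)"
      if "\<bar>h\<bar> < e" for h
    proof -
      have "((\<lambda>h. x + h *\<^sub>R b) has_derivative (\<lambda>k. k *\<^sub>R b)) (at h)"
        by (auto intro!: derivative_eq_intros)
      from has_derivative_compose[OF this g[OF e(2)[OF that], unfolded gderiv_def]]
      show ?thesis
        by (simp add: has_field_derivative_def inner_commute mult_commute_abs)
    qed
    have "((\<lambda>h. x + h *\<^sub>R b) has_derivative (\<lambda>k. k *\<^sub>R b)) (at 0)"
      by (auto intro!: derivative_eq_intros)
    from has_derivative_compose[OF this, of G H] G
    have "((\<lambda>h. G (x + h *\<^sub>R b)) has_derivative (\<lambda>k. H (k *\<^sub>R b))) (at 0)"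
      by simp
    then have "((\<lambda>h. G (x + h *\<^sub>R b) \<bullet> b) has_derivative (\<lambda>k. H (k *\<^sub>R b) \<bullet> b)) (at 0)"
      by (rule has_derivative_inner_left)
    then have "((\<lambda>h. G (x + h *\<^sub>R b) \<bullet> b) has_real_derivative H b \<bullet> b) (at 0)"
      by (simp add: has_field_derivative_def linear_cmul[OF has_derivative_linear[OF G]] mult_commute_abs)
    from has_real_derivative_neg_dec_right[OF this] neg obtain d where
      d: "d > 0" "\<And>h. 0 < h \<Longrightarrow> h < d \<Longrightarrow> G (x + h *\<^sub>R b) \<bullet> b < 0"
      by (auto simp: G0)
    define k where "k = min d e / 2"
    have k: "0 < k" "k < d" "k < e"
      using d(1) e(1) by (auto simp: k_def min_def)
    obtain \<xi> where "0 < \<xi>" "\<xi> < k"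
      and "g (x + k *\<^sub>R b) - g (x + 0 *\<^sub>R b) = (k - 0) * (G (x + \<xi> *\<^sub>R b) \<bullet> b)"
      using MVT2[OF k(1), of "\<lambda>h. g (x + h *\<^sub>R b)" "\<lambda>h. G (x + h *\<^sub>R b) \<bullet> b"] slope k(3) by auto
    moreover have "k * (G (x + \<xi> *\<^sub>R b) \<bullet> b) < 0"
      using d(2)[of \<xi>] k \<open>0 < \<xi>\<close> \<open>\<xi> < k\<close> by (simp add: mult_pos_neg)
    ultimately have "g (x + k *\<^sub>R b) < g x"
      by simp
    with min[OF e(2), of k] k show False
      by simp
  qed
qed

text \<open>
  A negative minimum over the compact cylinder lies off the parabolic boundary, and there \<open>w\<^sub>t \<le> 0\<close>
  (at the final time the derivative is one-sided) while \<open>\<Delta>w \<ge> 0\<close>. The differential inequality is asked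
  for only at negative critical points because the gradient terms of a nonlinear equation disappear
  exactly there.
\<close>

lemma parabolic_minimum_principle:
  fixes w :: "'a::euclidean_space \<Rightarrow> real \<Rightarrow> real"
  assumes "open D" "bounded D"
    and cont: "continuous_on (closure D \<times> {0..b}) (\<lambda>(x, t). w x t)"
    and derivs: "parabolic_derivs D {0..b} w wt Dw D2w"
    and initial: "\<And>x. x \<in> D \<Longrightarrow> w x 0 \<ge> 0"
    and lateral: "\<And>x t. x \<in> frontier D \<Longrightarrow> 0 \<le> t \<Longrightarrow> t \<le> b \<Longrightarrow> w x t \<ge> 0"
    and heat: "\<And>x t. x \<in> D \<Longrightarrow> 0 < t \<Longrightarrow> t \<le> b \<Longrightarrow> w x t < 0 \<Longrightarrow> Dw x t = 0 \<Longrightarrow>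
      wt x t - laplacian_of_D2 (D2w x t) > 0"
    and "x \<in> closure D" "0 \<le> t" "t \<le> b"
  shows "w x t \<ge> 0"
proof (rule ccontr)
  assume neg: "\<not> ?thesis"
  have "compact (closure D \<times> {0..b})"
    using \<open>bounded D\<close> by (intro compact_Times) auto
  moreover have "closure D \<times> {0..b} \<noteq> {}"
    using \<open>x \<in> closure D\<close> \<open>0 \<le> t\<close> \<open>t \<le> b\<close> by auto
  ultimately obtain p where "p \<in> closure D \<times> {0..b}"
    and "\<forall>q\<in>closure D \<times> {0..b}. (case p of (x, t) \<Rightarrow> w x t) \<le> (case q of (x, t) \<Rightarrow> w x t)"
    using continuous_attains_inf[OF _ _ cont] by blast
  then obtain y s where y: "y \<in> closure D" and s: "0 \<le> s" "s \<le> b"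
    and min: "\<And>y' s'. y' \<in> closure D \<Longrightarrow> 0 \<le> s' \<Longrightarrow> s' \<le> b \<Longrightarrow> w y s \<le> w y' s'"
    by (cases p) force
  have wneg: "w y s < 0"
    using min[of x t] assms neg by linarith
  then have "y \<in> D"
    using lateral[of y s] y s \<open>open D\<close> by (force simp: frontier_def interior_open)
  then have "s > 0"
    using initial[of y] wneg s(1) by (cases "s = 0") auto
  have sJ: "s \<in> {0..b}"
    using s by simp
  note sec = interior_minimum_second_order[OF \<open>open D\<close> \<open>y \<in> D\<close>
      parabolic_derivsD(2)[OF derivs _ sJ] parabolic_derivsD(3)[OF derivs \<open>y \<in> D\<close> sJ]
      min[OF closure_subset[THEN subsetD] s]]
  have "laplacian_of_D2 (D2w y s) \<ge> 0"
    unfolding laplacian_of_D2_def by (intro sum_nonneg sec)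
  moreover have "wt y s \<le> 0"
  proof (rule ccontr)
    assume "\<not> wt y s \<le> 0"
    then obtain d where d: "d > 0" "\<And>h. h > 0 \<Longrightarrow> s - h \<in> {0..b} \<Longrightarrow> h < d \<Longrightarrow> w y (s - h) < w y s"
      using has_real_derivative_pos_inc_left[OF parabolic_derivsD(1)[OF derivs \<open>y \<in> D\<close> sJ]] by auto
    define h where "h = min d s / 2"
    have "h > 0" "h < d" "h < s"
      using d(1) \<open>s > 0\<close> by (auto simp: h_def min_def)
    then show False
      using d(2)[of h] min[OF y, of "s - h"] s by auto
  qed
  ultimately show False
    using heat[OF \<open>y \<in> D\<close> \<open>s > 0\<close> s(2) wneg sec(1)] by simp
qed

section \<open>The transformed solution\<close>

text \<open>
  For the solution \<open>v\<close> of the equation without diffusion, \<open>quench_clock (v t) = \<lambda> t\<close>.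
\<close>

definition quench_clock :: "real \<Rightarrow> real" where
  "quench_clock v = (1 - (1 - v) ^ 3) / 3"

lemma atLeastAtMost_subset_time_interval:
  assumes "ereal b < S"
  shows "{0..b} \<subseteq> time_interval S"
proof
  fix t assume "t \<in> {0..b}"
  then show "t \<in> time_interval S"
    using le_less_trans[of "ereal t" "ereal b" S] assms by (simp add: time_interval_def)
qed

text \<open>
  Multiplying the equation by \<open>(1 - u)\<^sup>2\<close>, the derivative of \<open>quench_clock\<close> at \<open>u\<close>, cancels the singular
  denominator; the second derivative \<open>- 2 (1 - u)\<close> enters \<open>\<Delta>z\<close> with the square of the gradient, and so
  adds \<open>2 (1 - u) |\<nabla>u|\<^sup>2\<close> to the source, with a favourable sign when \<open>u < 1\<close>. Since \<open>u \<noteq> 1\<close>, the critical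
  points of \<open>z\<close> are those of \<open>u\<close>.
\<close>

lemma F_solution_clock_derivs:
  assumes sol: "F_solution \<Omega> lam \<delta> S u" and b: "ereal b < S" and pos: "lam > 0" "\<delta> \<ge> 0"
  obtains zt Dz D2z where
    "parabolic_derivs \<Omega> {0..b} (\<lambda>x t. quench_clock (u x t)) zt Dz D2z"
    and "\<And>x t. x \<in> \<Omega> \<Longrightarrow> t \<in> {0..b} \<Longrightarrow> Dz x t = 0 \<Longrightarrow>
      zt x t - laplacian_of_D2 (D2z x t) = lam"
    and "\<And>x t. x \<in> \<Omega> \<Longrightarrow> t \<in> {0..b} \<Longrightarrow> u x t < 1 \<Longrightarrow>
      zt x t - laplacian_of_D2 (D2z x t) \<ge> lam"
proof -
  have J: "t \<in> time_interval S" if "t \<in> {0..b}" for t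
    using atLeastAtMost_subset_time_interval[OF b] that by blast
  obtain ut Du D2u where C: "C21_derivs \<Omega> (time_interval S) u ut Du D2u"
    and eq: "\<And>x t. x \<in> \<Omega> \<Longrightarrow> t \<in> time_interval S \<Longrightarrow> u x t \<noteq> 1 \<and>
      ut x t - laplacian_of_D2 (D2u x t) = lam * (1 + \<delta> * (norm (Du x t))\<^sup>2) / (1 - u x t)\<^sup>2"
    using sol unfolding F_solution_def by blast
  have du: "parabolic_derivs \<Omega> {0..b} u ut Du D2u"
    using parabolic_derivs_subset[OF C21_derivs_imp_parabolic_derivs[OF C]] J by blast
  have f: "(quench_clock has_real_derivative (1 - v)\<^sup>2) (at v)" for v
    unfolding quench_clock_def by (auto intro!: derivative_eq_intros simp: field_simps power2_eq_square)
  have f': "((\<lambda>v. (1 - v)\<^sup>2) has_real_derivative - 2 * (1 - v)) (at v)" for v :: real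
    by (auto intro!: derivative_eq_intros)
  have heat: "(1 - u x t)\<^sup>2 * ut x t - laplacian_of_D2
        (\<lambda>h. (1 - u x t)\<^sup>2 *\<^sub>R D2u x t h + (- 2 * (1 - u x t) * (Du x t \<bullet> h)) *\<^sub>R Du x t)
      = lam * (1 + \<delta> * (norm (Du x t))\<^sup>2) + 2 * (1 - u x t) * (norm (Du x t))\<^sup>2"
    if "x \<in> \<Omega>" "t \<in> {0..b}" for x t
  proof -
    have "(1 - u x t)\<^sup>2 * (ut x t - laplacian_of_D2 (D2u x t)) = lam * (1 + \<delta> * (norm (Du x t))\<^sup>2)"
      using eq[OF that(1) J[OF that(2)]] by simp
    then show ?thesis
      unfolding laplacian_of_D2_compose by (simp add: algebra_simps)
  qed
  show ?thesis
  proof (rule that[OF parabolic_derivs_compose[OF du f f']], goal_cases)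
    case (1 x t)
    then show ?case
      using eq[OF 1(1) J[OF 1(2)]] heat[OF 1(1,2)] by simp
  next
    case (2 x t)
    then show ?case
      unfolding heat[OF 2(1,2)] using pos by (simp add: distrib_left add_increasing2)
  qed
qed

lemma F_solution_clock_continuous:
  assumes "F_solution \<Omega> lam \<delta> S u" "ereal b < S"
  shows "continuous_on (closure \<Omega> \<times> {0..b}) (\<lambda>(x, t). quench_clock (u x t))"
proof -
  have "continuous_on (closure \<Omega> \<times> {0..b}) (\<lambda>p. u (fst p) (snd p))"
    using assms(1) atLeastAtMost_subset_time_interval[OF assms(2)]
    unfolding F_solution_def split_def by (blast intro: continuous_on_subset)
  then show ?thesis
    by (auto simp: split_def quench_clock_def intro!: continuous_intros)
qed

lemma F_solution_parabolic_boundary: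
  assumes "F_solution \<Omega> lam \<delta> S u"
  shows "x \<in> \<Omega> \<Longrightarrow> u x 0 = 0"
    and "x \<in> frontier \<Omega> \<Longrightarrow> 0 \<le> t \<Longrightarrow> ereal t < S \<Longrightarrow> u x t = 0"
  using assms by (auto simp: F_solution_def time_interval_def)

section \<open>Bounds for the transformed solution\<close>

text \<open>
  At an interior maximum of \<open>z - at\<close> the gradient of \<open>u\<close> vanishes and diffusion can only lower \<open>z\<close>, so
  \<open>z\<close> grows at most at rate \<open>\<lambda>\<close>. The slope \<open>a\<close> is taken slightly larger than \<open>\<lambda>\<close> because the minimum
  principle asks for a strict inequality.
\<close>

lemma F_solution_clock_le:
  assumes sol: "F_solution \<Omega> lam \<delta> S u" and "open \<Omega>" "bounded \<Omega>" "lam > 0" "\<delta> \<ge> 0"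
    and x: "x \<in> \<Omega>" and t: "0 \<le> t" "ereal t < S"
  shows "quench_clock (u x t) \<le> lam * t"
proof (rule field_le_epsilon)
  fix e :: real assume "e > 0"
  define a where "a = lam + e / (t + 1)"
  have "a > lam"
    using \<open>e > 0\<close> t by (simp add: a_def)
  obtain zt Dz D2z where dz: "parabolic_derivs \<Omega> {0..t} (\<lambda>x t. quench_clock (u x t)) zt Dz D2z"
    and crit: "\<And>x s. x \<in> \<Omega> \<Longrightarrow> s \<in> {0..t} \<Longrightarrow> Dz x s = 0 \<Longrightarrow>
      zt x s - laplacian_of_D2 (D2z x s) = lam"
    using F_solution_clock_derivs[OF sol t(2) \<open>lam > 0\<close> \<open>\<delta> \<ge> 0\<close>] by metis
  have "t * (a - 0 * (norm (x - 0))\<^sup>2) - quench_clock (u x t) \<ge> 0"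
  proof (rule parabolic_minimum_principle[OF \<open>open \<Omega>\<close> \<open>bounded \<Omega>\<close> _
        parabolic_derivs_diff[OF parabolic_derivs_time_times_paraboloid dz]])
    show "continuous_on (closure \<Omega> \<times> {0..t})
        (\<lambda>(x, t). t * (a - 0 * (norm (x - 0))\<^sup>2) - quench_clock (u x t))"
      using F_solution_clock_continuous[OF sol t(2)]
      by (auto simp: split_def intro!: continuous_intros)
    show "x \<in> closure \<Omega>"
      using x closure_subset by blast
  next
    fix y assume "y \<in> \<Omega>"
    then show "0 * (a - 0 * (norm (y - 0))\<^sup>2) - quench_clock (u y 0) \<ge> 0"
      by (simp add: F_solution_parabolic_boundary[OF sol] quench_clock_def)
  next
    fix y s assume ys: "y \<in> frontier \<Omega>" "0 \<le> s" "s \<le> t"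
    then have "ereal s < S"
      using t(2) by (auto intro: le_less_trans[of _ "ereal t"])
    then show "s * (a - 0 * (norm (y - 0))\<^sup>2) - quench_clock (u y s) \<ge> 0"
      using ys \<open>a > lam\<close> \<open>lam > 0\<close>
      by (simp add: F_solution_parabolic_boundary[OF sol] quench_clock_def)
  next
    fix y s assume ys: "y \<in> \<Omega>" "0 < s" "s \<le> t" "(- 2 * 0 * s) *\<^sub>R (y - 0) - Dz y s = 0"
    then have "zt y s - laplacian_of_D2 (D2z y s) = lam"
      by (intro crit) auto
    then show "a - 0 * (norm (y - 0))\<^sup>2 - zt y s
        - laplacian_of_D2 (\<lambda>h. (- 2 * 0 * s) *\<^sub>R h - D2z y s h) > 0"
      using \<open>a > lam\<close> unfolding laplacian_of_D2_diff laplacian_of_D2_scaleR_id by simp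
  qed (use t in auto)
  moreover have "t * a \<le> lam * t + e"
    using \<open>e > 0\<close> t by (simp add: a_def field_simps)
  ultimately show "quench_clock (u x t) \<le> lam * t + e"
    by simp
qed

text \<open>
  At a negative interior minimum of \<open>z\<close> the source would be \<open>\<lambda> > 0\<close>. This gives \<open>u \<ge> 0\<close>, hence control of
  \<open>|u|\<close> in the sup norm, and the sign of \<open>z\<close> on the boundary of balls inside \<open>\<Omega>\<close>.
\<close>

lemma F_solution_clock_nonneg:
  assumes sol: "F_solution \<Omega> lam \<delta> S u" and "open \<Omega>" "bounded \<Omega>" "lam > 0" "\<delta> \<ge> 0"
    and x: "x \<in> \<Omega>" and t: "0 \<le> t" "ereal t < S"
  shows "quench_clock (u x t) \<ge> 0"
proof -
  obtain zt Dz D2z where dz: "parabolic_derivs \<Omega> {0..t} (\<lambda>x t. quench_clock (u x t)) zt Dz D2z"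
    and crit: "\<And>x s. x \<in> \<Omega> \<Longrightarrow> s \<in> {0..t} \<Longrightarrow> Dz x s = 0 \<Longrightarrow>
      zt x s - laplacian_of_D2 (D2z x s) = lam"
    using F_solution_clock_derivs[OF sol t(2) \<open>lam > 0\<close> \<open>\<delta> \<ge> 0\<close>] by metis
  show ?thesis
  proof (rule parabolic_minimum_principle[OF \<open>open \<Omega>\<close> \<open>bounded \<Omega>\<close>
        F_solution_clock_continuous[OF sol t(2)] dz])
    fix y assume "y \<in> \<Omega>"
    then show "quench_clock (u y 0) \<ge> 0"
      by (simp add: F_solution_parabolic_boundary[OF sol] quench_clock_def)
  next
    fix y s assume ys: "y \<in> frontier \<Omega>" "0 \<le> s" "s \<le> t"
    then have "ereal s < S"
      using t(2) by (auto intro: le_less_trans[of _ "ereal t"])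
    then show "quench_clock (u y s) \<ge> 0"
      using ys by (simp add: F_solution_parabolic_boundary[OF sol] quench_clock_def)
  next
    fix y s assume "y \<in> \<Omega>" "0 < s" "s \<le> t" "Dz y s = 0"
    then show "zt y s - laplacian_of_D2 (D2z y s) > 0"
      using crit[of y s] \<open>lam > 0\<close> by simp
  next
    show "x \<in> closure \<Omega>"
      using x closure_subset by blast
  qed (use t in auto)
qed

text \<open>
  Comparison on the ball with \<open>a t (1 - |x - x0|\<^sup>2 / r\<^sup>2)\<close>. The second hypothesis on \<open>a\<close> says that this is a
  strict subsolution up to time \<open>t\<close>: its Laplacian costs at most \<open>2 a t n / r\<^sup>2\<close>, where \<open>n\<close> is the
  dimension. The critical points of the difference are not those of \<open>u\<close>, so the gradient terms do not
  vanish there, and their sign has to come from \<open>u < 1\<close>.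
\<close>

lemma F_solution_clock_center_ge:
  fixes \<Omega> :: "'a::euclidean_space set"
  assumes sol: "F_solution \<Omega> lam \<delta> S u" and "open \<Omega>" "bounded \<Omega>" "lam > 0" "\<delta> \<ge> 0"
    and r: "r > 0" "cball x0 r \<subseteq> \<Omega>" and t: "0 \<le> t" "ereal t < S"
    and below: "\<And>x s. x \<in> \<Omega> \<Longrightarrow> 0 \<le> s \<Longrightarrow> s \<le> t \<Longrightarrow> u x s < 1"
    and a: "a \<ge> 0" "a + 2 * a * t * DIM('a) / r\<^sup>2 < lam"
  shows "quench_clock (u x0 t) \<ge> a * t"
proof -
  define c where "c = a / r\<^sup>2"
  have sub: "ball x0 r \<subseteq> \<Omega>" "closure (ball x0 r) = cball x0 r"
    using r ball_subset_cball by auto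
  obtain zt Dz D2z where dz: "parabolic_derivs \<Omega> {0..t} (\<lambda>x t. quench_clock (u x t)) zt Dz D2z"
    and super: "\<And>x s. x \<in> \<Omega> \<Longrightarrow> s \<in> {0..t} \<Longrightarrow> u x s < 1 \<Longrightarrow>
      zt x s - laplacian_of_D2 (D2z x s) \<ge> lam"
    using F_solution_clock_derivs[OF sol t(2) \<open>lam > 0\<close> \<open>\<delta> \<ge> 0\<close>] by metis
  have dz': "parabolic_derivs (ball x0 r) {0..t} (\<lambda>x t. quench_clock (u x t)) zt Dz D2z"
    using parabolic_derivs_subset[OF dz sub(1)] by simp
  have "quench_clock (u x0 t) - t * (a - c * (norm (x0 - x0))\<^sup>2) \<ge> 0"
  proof (rule parabolic_minimum_principle[OF open_ball bounded_ball _
        parabolic_derivs_diff[OF dz' parabolic_derivs_time_times_paraboloid]])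
    have "continuous_on (closure (ball x0 r) \<times> {0..t}) (\<lambda>(x, t). quench_clock (u x t))"
      by (rule continuous_on_subset[OF F_solution_clock_continuous[OF sol t(2)]])
        (use closure_mono[OF sub(1)] in blast)
    then show "continuous_on (closure (ball x0 r) \<times> {0..t})
        (\<lambda>(x, t). quench_clock (u x t) - t * (a - c * (norm (x - x0))\<^sup>2))"
      by (auto simp: split_def intro!: continuous_intros)
  next
    fix y assume "y \<in> ball x0 r"
    then have "y \<in> \<Omega>"
      using sub(1) by blast
    then show "quench_clock (u y 0) - 0 * (a - c * (norm (y - x0))\<^sup>2) \<ge> 0"
      by (simp add: F_solution_parabolic_boundary[OF sol] quench_clock_def)
  next
    fix y s assume ys: "y \<in> frontier (ball x0 r)" "0 \<le> s" "s \<le> t"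
    then have y: "norm (y - x0) = r" "y \<in> \<Omega>"
      using r by (auto simp: dist_norm norm_minus_commute)
    have "ereal s < S"
      using ys t(2) by (auto intro: le_less_trans[of _ "ereal t"])
    then have "quench_clock (u y s) \<ge> 0"
      using F_solution_clock_nonneg[OF sol \<open>open \<Omega>\<close> \<open>bounded \<Omega>\<close> \<open>lam > 0\<close> \<open>\<delta> \<ge> 0\<close> y(2) ys(2)] by simp
    then show "quench_clock (u y s) - s * (a - c * (norm (y - x0))\<^sup>2) \<ge> 0"
      using r(1) by (simp add: y(1) c_def)
  next
    fix y s assume ys: "y \<in> ball x0 r" "0 < s" "s \<le> t"
    then have "y \<in> \<Omega>"
      using sub(1) by blast
    then have z: "zt y s - laplacian_of_D2 (D2z y s) \<ge> lam"
      using super[of y s] below[of y s] ys by simp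
    have "2 * c * s * DIM('a) \<le> 2 * c * t * DIM('a)"
      using a(1) ys by (intro mult_right_mono mult_left_mono) (auto simp: c_def)
    moreover have "2 * c * t * DIM('a) = 2 * a * t * DIM('a) / r\<^sup>2"
      by (simp add: c_def)
    moreover have "c * (norm (y - x0))\<^sup>2 \<ge> 0"
      using a(1) by (simp add: c_def)
    ultimately show "zt y s - (a - c * (norm (y - x0))\<^sup>2)
        - laplacian_of_D2 (\<lambda>h. D2z y s h - (- 2 * c * s) *\<^sub>R h) > 0"
      using z a(2) unfolding laplacian_of_D2_diff laplacian_of_D2_scaleR_id by linarith
  qed (use t r in auto)
  then show ?thesis
    by (simp add: mult.commute)
qed

section \<open>Bounds for the quenching time\<close>

text \<open>
  The inequalities \<open>0 \<le> z \<le> \<lambda>t \<le> \<lambda>b\<close> solved for \<open>u\<close>. The bound is below 1 exactly when \<open>b < 1 / (3\<lambda>)\<close>.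
\<close>

lemma F_solution_sup_norm_le:
  assumes sol: "F_solution \<Omega> lam \<delta> S u" and "open \<Omega>" "bounded \<Omega>" "lam > 0" "\<delta> \<ge> 0"
    and t: "0 \<le> t" "ereal t < S" "t \<le> b"
  shows "sup_norm \<Omega> (\<lambda>x. u x t) \<le> ereal (1 - root 3 (1 - 3 * lam * b))"
  unfolding sup_norm_def
proof (rule SUP_least)
  fix x assume x: "x \<in> \<Omega>"
  have "0 \<le> quench_clock (u x t)" "quench_clock (u x t) \<le> lam * t"
    using F_solution_clock_nonneg[OF sol] F_solution_clock_le[OF sol] assms x by blast+
  moreover have "lam * t \<le> lam * b"
    using t \<open>lam > 0\<close> by simp
  ultimately have "root 3 (1 - 3 * lam * b) \<le> root 3 ((1 - u x t) ^ 3)"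
      "root 3 ((1 - u x t) ^ 3) \<le> root 3 1"
    by (auto simp: quench_clock_def)
  moreover have "root 3 ((1 - u x t) ^ 3) = 1 - u x t"
    by (rule odd_real_root_power_cancel) simp
  ultimately show "ereal \<bar>u x t\<bar> \<le> ereal (1 - root 3 (1 - 3 * lam * b))"
    by simp
qed

text \<open>
  A lifespan \<open>b < 1 / (3\<lambda>)\<close> would contradict maximality, as the sup norm would be bounded away from 1 on
  all of \<open>[0,b)\<close>. So the solution exists until \<open>1 / (3\<lambda>)\<close>, with sup norm below 1 before that time.
\<close>

lemma quenching_time_ge:
  assumes maxi: "maximal_F_solution \<Omega> lam \<delta> S u" and "open \<Omega>" "bounded \<Omega>" "lam > 0" "\<delta> \<ge> 0"
  shows "quenching_time \<Omega> S u \<ge> ereal (1 / (3 * lam))"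
proof -
  have sol: "F_solution \<Omega> lam \<delta> S u"
    using maxi by (simp add: maximal_F_solution_def)
  note bound = F_solution_sup_norm_le[OF sol \<open>open \<Omega>\<close> \<open>bounded \<Omega>\<close> \<open>lam > 0\<close> \<open>\<delta> \<ge> 0\<close>]
  have small: "ereal (1 - root 3 (1 - 3 * lam * b)) < 1" if "b < 1 / (3 * lam)" for b
    using that \<open>lam > 0\<close> by (simp add: field_simps one_ereal_def)
  have S: "S \<ge> ereal (1 / (3 * lam))"
  proof (rule ccontr)
    assume "\<not> ?thesis"
    moreover have "S > 0"
      using sol by (simp add: F_solution_def)
    ultimately obtain b where b: "S = ereal b" "b < 1 / (3 * lam)"
      by (cases S) auto
    have "(SUP t\<in>time_interval S. sup_norm \<Omega> (\<lambda>x. u x t)) \<le> ereal (1 - root 3 (1 - 3 * lam * b))"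
      by (rule SUP_least, rule bound) (auto simp: time_interval_def b(1))
    also have "\<dots> < 1"
      by (rule small[OF b(2)])
    finally have "\<not> 1 \<le> (SUP t\<in>time_interval S. sup_norm \<Omega> (\<lambda>x. u x t))"
      by (simp only: not_le)
    moreover have "S < \<infinity>"
      using b(1) by simp
    ultimately show False
      using maxi unfolding maximal_F_solution_def by blast
  qed
  show ?thesis
  proof (rule dense_le)
    fix y assume y: "y < ereal (1 / (3 * lam))"
    have "max 0 (real_of_ereal y) < 1 / (3 * lam)"
      using y \<open>lam > 0\<close> by (cases y) auto
    then obtain t where t: "0 < t" "t < 1 / (3 * lam)" "real_of_ereal y \<le> t"
      using dense[of "max 0 (real_of_ereal y)" "1 / (3 * lam)"] by force
    have "ereal t < S"
      using t(2) S by (auto intro: less_le_trans[of _ "ereal (1 / (3 * lam))"])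
    moreover have "sup_norm \<Omega> (\<lambda>x. u x s) < 1" if "s \<in> {0..t}" for s
    proof -
      have "ereal s < S"
        using that \<open>ereal t < S\<close> by (auto intro: le_less_trans[of _ "ereal t"])
      then show ?thesis
        using le_less_trans[OF bound[of s t] small[OF t(2)]] that by simp
    qed
    ultimately have "ereal t \<le> quenching_time \<Omega> S u"
      unfolding quenching_time_def using t(1) by (intro Sup_upper) auto
    moreover have "y \<le> ereal t"
      using t(3) y by (cases y) auto
    ultimately show "y \<le> quenching_time \<Omega> S u"
      by (rule order_trans[rotated])
  qed
qed

text \<open>
  If the solution stayed below 1 beyond \<open>t = 1 / (3a)\<close>, then at the centre of the ball \<open>z \<ge> at = 1 / 3\<close>
  would force \<open>u \<ge> 1\<close>. The second hypothesis on \<open>a\<close> is the subsolution condition at that time.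
\<close>

lemma quenching_time_le:
  fixes \<Omega> :: "'a::euclidean_space set"
  assumes sol: "F_solution \<Omega> lam \<delta> S u" and "open \<Omega>" "bounded \<Omega>" "lam > 0" "\<delta> \<ge> 0"
    and r: "r > 0" "cball x0 r \<subseteq> \<Omega>" and a: "a > 0" "a + 2 * DIM('a) / (3 * r\<^sup>2) < lam"
  shows "quenching_time \<Omega> S u \<le> ereal (1 / (3 * a))"
  unfolding quenching_time_def
proof (rule Sup_least, clarify)
  fix T assume T: "0 < T" "ereal T < S" "\<forall>s\<in>{0..T}. sup_norm \<Omega> (\<lambda>x. u x s) < 1"
  have below: "u x s < 1" if "x \<in> \<Omega>" "0 \<le> s" "s \<le> T" for x s
  proof -
    have "ereal \<bar>u x s\<bar> \<le> sup_norm \<Omega> (\<lambda>x. u x s)"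
      unfolding sup_norm_def using that(1) by (rule SUP_upper)
    also have "\<dots> < 1"
      using T(3) that by simp
    finally show ?thesis
      by (simp add: one_ereal_def)
  qed
  show "ereal T \<le> ereal (1 / (3 * a))"
  proof (rule ccontr)
    define t where "t = 1 / (3 * a)"
    assume "\<not> ?thesis"
    then have t: "0 \<le> t" "t \<le> T"
      using a by (auto simp: t_def)
    then have "ereal t < S"
      using T(2) by (auto intro: le_less_trans[of _ "ereal T"])
    moreover have "a + 2 * a * t * DIM('a) / r\<^sup>2 < lam"
      using a by (simp add: t_def)
    ultimately have "quench_clock (u x0 t) \<ge> a * t"
      using F_solution_clock_center_ge[OF sol \<open>open \<Omega>\<close> \<open>bounded \<Omega>\<close> \<open>lam > 0\<close> \<open>\<delta> \<ge> 0\<close> r t(1), of a]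
        below t a(1) by auto
    then have "(1 - u x0 t) ^ 3 \<le> 0"
      using a(1) by (simp add: t_def quench_clock_def)
    moreover have "u x0 t < 1"
      using below[of x0 t] t r(1) subsetD[OF r(2), of x0] by simp
    ultimately show False
      using zero_less_power[of "1 - u x0 t" 3] by simp
  qed
qed

theorem theorem1p2:
  fixes \<Omega> :: "'a::euclidean_space set"
    and \<delta> :: real
    and S :: "real \<Rightarrow> ereal"
    and u :: "real \<Rightarrow> 'a \<Rightarrow> real \<Rightarrow> real"
  assumes "open \<Omega>" and "connected \<Omega>" and "\<Omega> \<noteq> {}" and "bounded \<Omega>"
    and "\<delta> > 0"
    and "\<And>lam. lam > 0 \<Longrightarrow> maximal_F_solution \<Omega> lam \<delta> (S lam) (u lam)"
  shows "Limsup at_top (\<lambda>lam. ereal lam * quenching_time \<Omega> (S lam) (u lam)) = ereal (1 / 3)"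
proof -
  obtain x0 r where r: "r > 0" "cball x0 r \<subseteq> \<Omega>"
    using \<open>open \<Omega>\<close> \<open>\<Omega> \<noteq> {}\<close> unfolding open_contains_cball by blast
  \<comment> \<open>The slope \<open>a = lam - K\<close> meets the subsolution condition on the ball; the summand 1 makes it strict.\<close>
  define K where "K = 2 * real DIM('a) / (3 * r\<^sup>2) + 1"
  have "K > 0"
    by (auto simp: K_def intro!: add_nonneg_pos)
  have "eventually (\<lambda>lam. ereal (1 / 3) \<le> ereal lam * quenching_time \<Omega> (S lam) (u lam)) at_top"
    using eventually_gt_at_top[of 0]
  proof eventually_elim
    case (elim lam)
    have "ereal lam * ereal (1 / (3 * lam)) \<le> ereal lam * quenching_time \<Omega> (S lam) (u lam)"
      using quenching_time_ge[OF assms(6)[OF elim] \<open>open \<Omega>\<close> \<open>bounded \<Omega>\<close> elim] \<open>\<delta> > 0\<close> elim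
      by (intro ereal_mult_left_mono) auto
    then show ?case
      using elim by simp
  qed
  moreover have "eventually (\<lambda>lam. ereal lam * quenching_time \<Omega> (S lam) (u lam)
      \<le> ereal (lam / (3 * (lam - K)))) at_top"
    using eventually_gt_at_top[of K]
  proof eventually_elim
    case (elim lam)
    have "lam > 0"
      using elim \<open>K > 0\<close> by simp
    then have sol: "F_solution \<Omega> lam \<delta> (S lam) (u lam)"
      using assms(6)[OF \<open>lam > 0\<close>] by (simp add: maximal_F_solution_def)
    have "quenching_time \<Omega> (S lam) (u lam) \<le> ereal (1 / (3 * (lam - K)))"
    proof (rule quenching_time_le[OF sol \<open>open \<Omega>\<close> \<open>bounded \<Omega>\<close> \<open>lam > 0\<close> _ r])
      show "lam - K + 2 * DIM('a) / (3 * r\<^sup>2) < lam"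
        by (simp add: K_def)
    qed (use elim \<open>\<delta> > 0\<close> in auto)
    then have "ereal lam * quenching_time \<Omega> (S lam) (u lam) \<le> ereal lam * ereal (1 / (3 * (lam - K)))"
      using \<open>lam > 0\<close> by (intro ereal_mult_left_mono) auto
    then show ?case
      by simp
  qed
  moreover have "((\<lambda>lam. ereal (lam / (3 * (lam - K)))) \<longlongrightarrow> ereal (1 / 3)) at_top"
    unfolding lim_ereal by real_asymp
  ultimately have "((\<lambda>lam. ereal lam * quenching_time \<Omega> (S lam) (u lam)) \<longlongrightarrow> ereal (1 / 3)) at_top"
    by (rule tendsto_sandwich[OF _ _ tendsto_const])
  then show ?thesis
    by (intro lim_imp_Limsup) simp
qed

end
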